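(* Let $X=\{x\in\mathbb{R}^n : Ax=b,\ x\geq 0\}$ with $A\in\mathbb{Q}^{m\times n}$, $b\in\mathbb{Q}^m$, let $c_1,c_2,d_1\in\mathbb{Q}^n$ be (row) objective vectors, and let $j\in\{1,2\}$. A set $S\subseteq X$ is a minimal solution set for TOLP if and only if $S$ is a minimal solution set for $\mathrm{PBLP}^j$.
   Context: For $\lambda\ge 0$, $\mathrm{PBLP}^1(\lambda)$ is the biobjective linear program $\min_{x\in X}(c_1x+\lambda d_1x,\ c_2x)^\top$ and $\mathrm{PBLP}^2(\lambda)$ is $\min_{x\in X}(c_1x+\lambda d_1x,\ c_2x+\lambda d_1x)^\top$; $\mathrm{PBLP}^j$ denotes the corresponding parametric problem over all $\lambda\geq 0$. TOLP is the triobjective linear program $\min_{x\in X}(c_1x,c_2x,d_1x)^\top$. For a multi-objective linear program $\min_{x\in X}Cx$ with $C\in\mathbb{R}^{k\times n}$, the image set is $Y=\{Cx:x\in X\}$. An image $y^*\in Y$ is nondominated if there is no $y\in Y$ with $y\neq y^*$ and $y_i\le y_i^*$ for all $i$. $y$ is an extreme nondominated image if it is nondominated and an extreme point of the polyhedron $Y$; the set of these is $Y_{\mathrm{EN}}$. A solution set of the multi-objective linear program is a set $S\subseteq X$ such that for every $y\in Y_{\mathrm{EN}}$ there is $x\in S$ with $Cx=y$; it is minimal if there is no solution set $S'\subseteq X$ with $|S'|<|S|$. A solution set of $\mathrm{PBLP}^j$ is a set $S\subseteq X$ such that for every $\lambda\ge 0$, $S$ contains as a subset a solution set for the biobjective linear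 program $\mathrm{PBLP}^j(\lambda)$; it is minimal if there is no solution set $S'\subseteq X$ for $\mathrm{PBLP}^j$ with $|S'|<|S|$.
   Formalization: The formal theorem additionally assumes that TOLP has at least one extreme nondominated image whenever X is nonempty; without this the claim fails, e.g. for X the nonnegative reals, c1 = c2 = 0, d1 = -1, where PBLP^j(0) has an extreme nondominated image but TOLP has none. *)

theory Defs
  imports "HOL-Analysis.Analysis"
begin

definition feasible_set :: "real^'n^'m \<Rightarrow> real^'m \<Rightarrow> (real^'n) set" where
  "feasible_set A b = {x. A *v x = b \<and> (\<forall>i. 0 \<le> x $ i)}"

definition image_set :: "real^'n^'k \<Rightarrow> (real^'n) set \<Rightarrow> (real^'k) set" where
  "image_set C X = {C *v x | x. x \<in> X}"

definition nondominated :: "(real^'k) set \<Rightarrow> real^'k \<Rightarrow> bool" where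
  "nondominated Y y \<longleftrightarrow> y \<in> Y \<and> \<not> (\<exists>y'\<in>Y. y' \<noteq> y \<and> (\<forall>i. y' $ i \<le> y $ i))"

definition extreme_nondominated :: "real^'n^'k \<Rightarrow> (real^'n) set \<Rightarrow> (real^'k) set" where
  "extreme_nondominated C X =
     {y. nondominated (image_set C X) y \<and> y extreme_point_of (image_set C X)}"

definition solution_set :: "real^'n^'k \<Rightarrow> (real^'n) set \<Rightarrow> (real^'n) set \<Rightarrow> bool" where
  "solution_set C X S \<longleftrightarrow>
     S \<subseteq> X \<and> (\<forall>y \<in> extreme_nondominated C X. \<exists>x\<in>S. C *v x = y)"

text \<open>Cardinalities are compared with \<open>\<prec>\<close>, not with \<^const>\<open>card\<close>, because a solution
  set may be infinite.\<close>

definition minimal_solution_set ::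
    "real^'n^'k \<Rightarrow> (real^'n) set \<Rightarrow> (real^'n) set \<Rightarrow> bool" where
  "minimal_solution_set C X S \<longleftrightarrow>
     solution_set C X S \<and> \<not> (\<exists>S'. solution_set C X S' \<and> S' \<prec> S)"

text \<open>A parametric problem is given by its objective matrix as a function of \<open>\<lambda>\<close>; only the
  values at \<open>\<lambda> \<ge> 0\<close> matter.\<close>

definition parametric_solution_set ::
    "(real \<Rightarrow> real^'n^'k) \<Rightarrow> (real^'n) set \<Rightarrow> (real^'n) set \<Rightarrow> bool" where
  "parametric_solution_set P X S \<longleftrightarrow>
     S \<subseteq> X \<and> (\<forall>l\<ge>0. \<exists>T\<subseteq>S. solution_set (P l) X T)"

definition minimal_parametric_solution_set ::
    "(real \<Rightarrow> real^'n^'k) \<Rightarrow> (real^'n) set \<Rightarrow> (real^'n) set \<Rightarrow> bool" where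
  "minimal_parametric_solution_set P X S \<longleftrightarrow>
     parametric_solution_set P X S \<and>
     \<not> (\<exists>S'. parametric_solution_set P X S' \<and> S' \<prec> S)"

definition tolp :: "real^'n \<Rightarrow> real^'n \<Rightarrow> real^'n \<Rightarrow> real^'n^3" where
  "tolp c1 c2 d1 = vector [c1, c2, d1]"

definition pblp1 :: "real^'n \<Rightarrow> real^'n \<Rightarrow> real^'n \<Rightarrow> real \<Rightarrow> real^'n^2" where
  "pblp1 c1 c2 d1 l = vector [c1 + l *\<^sub>R d1, c2]"

definition pblp2 :: "real^'n \<Rightarrow> real^'n \<Rightarrow> real^'n \<Rightarrow> real \<Rightarrow> real^'n^2" where
  "pblp2 c1 c2 d1 l = vector [c1 + l *\<^sub>R d1, c2 + l *\<^sub>R d1]"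

definition pblp :: "nat \<Rightarrow> real^'n \<Rightarrow> real^'n \<Rightarrow> real^'n \<Rightarrow> real \<Rightarrow> real^'n^2" where
  "pblp j = (if j = 1 then pblp1 else pblp2)"

end

theory Submission
  imports Defs
begin

text \<open>
  The two problems have the same solution sets, hence the same minimal ones. Let \<open>Y\<close> be the image
  of TOLP, and \<open>M\<^sub>\<lambda>\<close> the monotone linear map that sends \<open>Y\<close> onto the image of \<open>PBLP\<^sup>j(\<lambda>)\<close>.

  The feasible directions of \<open>Y\<close> at an extreme nondominated image \<open>y\<close>, together with the
  nonnegative orthant, generate a closed pointed cone, so some weight \<open>w > 0\<close> grows at least
  linearly with the distance from \<open>y\<close> on \<open>Y\<close>. Taking \<open>\<lambda> = w\<^sub>3 / w\<^sub>1\<close> for \<open>j = 1\<close>, or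
  \<open>\<lambda> = w\<^sub>3 / (w\<^sub>1 + w\<^sub>2)\<close> for \<open>j = 2\<close>, makes \<open>w\<close> factor through \<open>M\<^sub>\<lambda>\<close>. Then \<open>M\<^sub>\<lambda> y\<close> is extreme
  nondominated and \<open>y\<close> is its only preimage in \<open>Y\<close>, so every parametric solution set attains \<open>y\<close>.

  Conversely, an extreme nondominated image of \<open>PBLP\<^sup>j(\<lambda>)\<close> has a face of \<open>Y\<close> as preimage, and an
  extreme point of the part of this face where \<open>w\<close> is minimal is extreme nondominated in \<open>Y\<close>.
\<close>

section \<open>Polyhedral and pointed cones\<close>

text \<open>The guard \<open>P\<close> makes room for sign constraints imposed only at the
  coordinates active at a point.\<close>

lemma polyhedron_linear_nonneg:
  fixes f :: "'i::finite \<Rightarrow> 'a::euclidean_space \<Rightarrow> real"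
  assumes "\<And>i. linear (f i)"
  shows "polyhedron {x. \<forall>i. P i \<longrightarrow> 0 \<le> f i x}"
proof -
  have eq: "f i x = adjoint (f i) 1 \<bullet> x" for i x
    using adjoint_clauses(2)[OF assms[of i], of 1 x] by simp
  have "{x. \<forall>i. P i \<longrightarrow> 0 \<le> f i x} = \<Inter> ((\<lambda>i. {x. adjoint (f i) 1 \<bullet> x \<ge> 0}) ` {i. P i})"
    by (auto simp: eq)
  moreover have "polyhedron \<dots>"
    by (rule polyhedron_Inter) (auto simp: polyhedron_halfspace_ge)
  ultimately show ?thesis by simp
qed

lemma polyhedron_linear_kernel:
  fixes f :: "'a::euclidean_space \<Rightarrow> 'b::euclidean_space"
  assumes "linear f"
  shows "polyhedron {x. f x = 0}"
  by (intro affine_imp_polyhedron subspace_imp_affine linear_subspace_kernel assms)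

text \<open>Linear images of closed cones can fail to be closed. Here a box cuts \<open>D\<close>
  down to a polytope that still generates it, and the conic hull of the image polytope is
  closed.\<close>

lemma closed_linear_image_polyhedral_cone:
  fixes f :: "'a::euclidean_space \<Rightarrow> 'b::euclidean_space"
  assumes "polyhedron D" "conic D" "linear f"
  shows "closed (f ` D)"
proof -
  define B where "B = D \<inter> cbox (-One) One"
  have "polytope B"
    unfolding B_def polytope_eq_bounded_polyhedron using assms(1) by (simp add: bounded_Int)
  then have "polytope (f ` B)"
    using assms(3) by (simp add: polytope_linear_image)
  moreover have "f ` D = conic hull (f ` B)"
  proof -
    have "d \<in> conic hull B" if "d \<in> D" for d
    proof -
      \<comment> \<open>The \<open>+ 1\<close> scales \<open>d\<close> into the box without a
        special case for \<open>d = 0\<close>.\<close>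
      define e where "e = (1 / (norm d + 1)) *\<^sub>R d"
      have np: "norm d + 1 > 0" by (smt (verit) norm_ge_zero)
      have "e \<in> D"
        using assms(2) that np unfolding e_def by (auto simp: conic_def)
      moreover have "e \<in> cbox (-One) One"
      proof -
        have "\<bar>e \<bullet> i\<bar> \<le> 1" if "i \<in> Basis" for i
        proof -
          have "\<bar>e \<bullet> i\<bar> \<le> norm e" using that by (rule Basis_le_norm)
          also have "\<dots> \<le> 1" using np by (simp add: e_def)
          finally show ?thesis .
        qed
        then show ?thesis by (auto simp: mem_box abs_le_iff)
      qed
      moreover have "d = (norm d + 1) *\<^sub>R e" using np by (simp add: e_def)
      ultimately show ?thesis
        unfolding conic_hull_explicit B_def using np by (smt (verit) IntI mem_Collect_eq)
    qed
    moreover have "conic hull B \<subseteq> D"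
      by (rule hull_minimal) (use assms(2) in \<open>auto simp: B_def\<close>)
    ultimately have "conic hull B = D" by auto
    then show ?thesis using conic_hull_linear_image[OF assms(3), of B] by simp
  qed
  ultimately show ?thesis by (simp add: closed_conic_hull_strong)
qed

text \<open>The unit vectors of \<open>K\<close> have a compact convex hull, which pointedness keeps
  away from the origin. Separating it from 0 bounds \<open>w\<close> from below on unit vectors;
  homogeneity does the rest.\<close>

lemma pointed_cone_coercive_functional:
  fixes K :: "'a::euclidean_space set"
  assumes "closed K" "convex_cone K" and pointed: "\<And>k. k \<in> K \<Longrightarrow> -k \<in> K \<Longrightarrow> k = 0"
  obtains w \<delta> where "\<delta> > 0" "\<And>k. k \<in> K \<Longrightarrow> \<delta> * norm k \<le> w \<bullet> k"
proof -
  have "convex (K - {0})"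
    unfolding convex_def
  proof clarsimp
    fix a c :: 'a and u v :: real
    assume a: "a \<in> K" "a \<noteq> 0" and c: "c \<in> K" "c \<noteq> 0" and uv: "0 \<le> u" "0 \<le> v" "u + v = 1"
    have in_K: "u *\<^sub>R a \<in> K" "v *\<^sub>R c \<in> K"
      using assms(2) a c uv by (auto intro: convex_cone_scaleR)
    moreover have False if "u *\<^sub>R a + v *\<^sub>R c = 0"
    proof -
      have "v *\<^sub>R c = - (u *\<^sub>R a)" using that by (simp add: add_eq_0_iff)
      then have "u *\<^sub>R a = 0" using pointed[of "u *\<^sub>R a"] in_K by simp
      then show False using that a c uv by simp
    qed
    ultimately show "u *\<^sub>R a + v *\<^sub>R c \<in> K \<and> u *\<^sub>R a + v *\<^sub>R c \<noteq> 0"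
      using assms(2) by (auto intro: convex_cone_add)
  qed
  define H where "H = convex hull (K \<inter> sphere 0 1)"
  have "H \<subseteq> K - {0}"
    unfolding H_def by (rule hull_minimal) (use \<open>convex (K - {0})\<close> in auto)
  moreover have "compact H"
    unfolding H_def using assms(1) by (intro compact_convex_hull closed_Int_compact) auto
  ultimately obtain w \<delta> where w: "\<delta> > 0" "\<And>x. x \<in> H \<Longrightarrow> w \<bullet> x > \<delta>"
    using separating_hyperplane_closed_0[of H] compact_imp_closed
    by (metis Diff_iff H_def convex_convex_hull insertI1 subset_iff)
  have "\<delta> * norm k \<le> w \<bullet> k" if "k \<in> K" for k
  proof (cases "k = 0")
    case False
    have "(1 / norm k) *\<^sub>R k \<in> K \<inter> sphere 0 1"
      using that False assms(2) by (auto intro: convex_cone_scaleR)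
    then have "(1 / norm k) *\<^sub>R k \<in> H" unfolding H_def by (rule hull_inc)
    then have "w \<bullet> ((1 / norm k) *\<^sub>R k) > \<delta>" by (rule w)
    then show ?thesis using False by (simp add: field_simps)
  qed simp
  then show thesis using that w(1) by blast
qed

section \<open>The image of the feasible set\<close>

lemma image_set_eq_image: "image_set C X = (*v) C ` X"
  by (auto simp: image_set_def)

lemma convex_feasible_set: "convex (feasible_set A b)"
  unfolding convex_def feasible_set_def
  by (auto simp: matrix_vector_right_distrib matrix_vector_mult_scaleR simp flip: scaleR_left_distrib)

lemma convex_image_feasible_set: "convex (image_set C (feasible_set A b))"
  unfolding image_set_eq_image
  by (intro convex_linear_image convex_feasible_set matrix_vector_mul_linear)

text \<open>By homogenisation, the image set is the slice at height 1 of a linear image of a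
  polyhedral cone.\<close>

lemma closed_image_feasible_set:
  fixes C :: "real^'n^'k" and A :: "real^'n^'m"
  shows "closed (image_set C (feasible_set A b))"
proof -
  \<comment> \<open>The second component \<open>t\<close> turns \<open>A x = b\<close> into
    \<open>A x = t b\<close>. The index type \<open>unit\<close> brings the single inequality
    \<open>0 \<le> t\<close> into the form of \<open>polyhedron_linear_nonneg\<close>.\<close>
  define D :: "((real^'n) \<times> real) set" where
    "D = {p. A *v fst p - snd p *\<^sub>R b = 0} \<inter> {p. \<forall>i. True \<longrightarrow> 0 \<le> fst p $ i}
         \<inter> {p. \<forall>i::unit. True \<longrightarrow> 0 \<le> snd p}"
  define f :: "(real^'n) \<times> real \<Rightarrow> (real^'k) \<times> real" where "f p = (C *v fst p, snd p)" for p
  have "polyhedron D"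
    unfolding D_def
    by (intro polyhedron_Int polyhedron_linear_nonneg polyhedron_linear_kernel)
      (auto intro!: linearI simp: algebra_simps matrix_vector_right_distrib matrix_vector_mult_scaleR)
  moreover have "conic D"
    unfolding D_def conic_def by (auto simp: matrix_vector_mult_scaleR simp flip: scaleR_scaleR)
  moreover have "linear f"
    unfolding f_def
    by (auto intro!: linearI simp: matrix_vector_right_distrib matrix_vector_mult_scaleR)
  ultimately have "closed (f ` D)" by (rule closed_linear_image_polyhedral_cone)
  then have "closed ((\<lambda>y. (y, 1)) -` (f ` D))"
    by (rule closed_vimage) (intro continuous_intros)
  also have "(\<lambda>y. (y, 1)) -` (f ` D) = image_set C (feasible_set A b)"
    by (auto simp: D_def f_def image_set_def feasible_set_def image_iff
        intro!: bexI[of _ "(_, 1)"])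
  finally show ?thesis .
qed

section \<open>Feasible directions and coercive weights\<close>

text \<open>Active coordinates do not decrease, and inactive ones stay positive for small
  \<open>t\<close>. The filter form lets several directions share one step length.\<close>

lemma eventually_feasible_direction:
  fixes A :: "real^'n^'m"
  assumes "x \<in> feasible_set A b" "A *v d = 0" "\<And>i. x $ i = 0 \<Longrightarrow> 0 \<le> d $ i"
  shows "eventually (\<lambda>t. x + t *\<^sub>R d \<in> feasible_set A b) (at_right 0)"
proof -
  have "eventually (\<lambda>t. 0 \<le> x $ i + t * d $ i) (at_right 0)" for i
  proof (cases "x $ i = 0")
    case True
    then show ?thesis
      using assms(3)[of i] by (auto simp: eventually_at_filter)
  next
    case False
    then have "x $ i > 0" using assms(1) by (auto simp: feasible_set_def less_le)
    moreover have "((\<lambda>t. x $ i + t * d $ i) \<longlongrightarrow> x $ i + 0 * d $ i) (at_right 0)"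
      by (intro tendsto_intros)
    ultimately have "eventually (\<lambda>t. 0 < x $ i + t * d $ i) (at_right 0)"
      using order_tendstoD(1) by fastforce
    then show ?thesis by (rule eventually_mono) simp
  qed
  then have "eventually (\<lambda>t. \<forall>i. 0 \<le> x $ i + t * d $ i) (at_right 0)"
    by (intro eventually_all_finite)
  then show ?thesis
    by (rule eventually_mono)
      (use assms in \<open>auto simp: feasible_set_def matrix_vector_right_distrib matrix_vector_mult_scaleR\<close>)
qed

text \<open>Pointedness of the cone has two sources: nondominance kills the orthant part and
  extremality the direction part.\<close>

lemma extreme_nondominated_coercive_weights:
  fixes C :: "real^'n^'k" and A :: "real^'n^'m"
  assumes "y \<in> extreme_nondominated C (feasible_set A b)"
  obtains w \<delta> where "\<delta> > 0" "\<And>i. w $ i > 0"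
    "\<And>y'. y' \<in> image_set C (feasible_set A b) \<Longrightarrow> \<delta> * norm (y' - y) \<le> w \<bullet> (y' - y)"
proof -
  let ?X = "feasible_set A b" and ?Y = "image_set C (feasible_set A b)"
  have nd: "\<And>y'. y' \<in> ?Y \<Longrightarrow> (\<And>i. y' $ i \<le> y $ i) \<Longrightarrow> y' = y"
    and ext: "y extreme_point_of ?Y" and "y \<in> ?Y"
    using assms by (auto simp: extreme_nondominated_def nondominated_def)
  then obtain x where x: "x \<in> ?X" "C *v x = y" by (auto simp: image_set_def)
  \<comment> \<open>Pairs of a feasible direction at \<open>x\<close> and a vector of the orthant;
    \<open>f\<close> sends them onto the cone to be shown pointed.\<close>
  define D :: "((real^'n) \<times> (real^'k)) set" where
    "D = {p. A *v fst p = 0} \<inter> {p. \<forall>i. x $ i = 0 \<longrightarrow> 0 \<le> fst p $ i}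
         \<inter> {p. \<forall>i. True \<longrightarrow> 0 \<le> snd p $ i}"
  define f :: "(real^'n) \<times> (real^'k) \<Rightarrow> real^'k" where "f p = C *v fst p + snd p" for p
  have "polyhedron D"
    unfolding D_def
    by (intro polyhedron_Int polyhedron_linear_nonneg polyhedron_linear_kernel)
      (auto intro!: linearI simp: algebra_simps matrix_vector_right_distrib matrix_vector_mult_scaleR)
  have "convex_cone D"
    unfolding D_def convex_cone_iff
    by (auto simp: matrix_vector_right_distrib matrix_vector_mult_scaleR)
  have "linear f"
    unfolding f_def
    by (auto intro!: linearI simp: algebra_simps matrix_vector_right_distrib matrix_vector_mult_scaleR)
  have "closed (f ` D)"
    using \<open>polyhedron D\<close> \<open>convex_cone D\<close> \<open>linear f\<close>
    by (intro closed_linear_image_polyhedral_cone) (auto simp: convex_cone_def)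
  moreover have "convex_cone (f ` D)"
    using \<open>convex_cone D\<close> \<open>linear f\<close> by (simp add: convex_cone_linear_image)
  moreover have "k = 0" if k: "k \<in> f ` D" "- k \<in> f ` D" for k
  proof -
    obtain d r d' r' where p: "(d, r) \<in> D" "k = C *v d + r" "(d', r') \<in> D" "-k = C *v d' + r'"
      using k unfolding f_def by force
    have "(d + d', r + r') \<in> D"
      using convex_cone_add[OF \<open>convex_cone D\<close> p(1,3)] by simp
    have r: "\<And>i. 0 \<le> r $ i" "\<And>i. 0 \<le> r' $ i" using p by (auto simp: D_def)
    have Cdd: "C *v d + C *v d' = - (r + r')"
      using p(2,4) by (metis (no_types, lifting) add.assoc add.commute add.left_commute
        add.right_inverse add_eq_0_iff)
    have "eventually (\<lambda>t. x + t *\<^sub>R d \<in> ?X \<and> x + t *\<^sub>R d' \<in> ?X \<and> x + t *\<^sub>R (d + d') \<in> ?X \<and> 0 < t)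
            (at_right 0)"
      using p(1,3) \<open>(d + d', r + r') \<in> D\<close> x(1)
      by (intro eventually_conj eventually_feasible_direction eventually_at_right_less)
        (auto simp: D_def)
    then obtain t where t: "x + t *\<^sub>R d \<in> ?X" "x + t *\<^sub>R d' \<in> ?X" "x + t *\<^sub>R (d + d') \<in> ?X" "0 < t"
      using eventually_happens'[of "at_right (0::real)"] trivial_limit_at_right_real by blast
    have step: "y + t *\<^sub>R (C *v e) \<in> ?Y" if "x + t *\<^sub>R e \<in> ?X" for e
      using imageI[OF that, of "(*v) C"] x(2)
      by (simp add: image_set_eq_image matrix_vector_right_distrib matrix_vector_mult_scaleR)
    \<comment> \<open>The step along \<open>d + d'\<close> reaches an image weakly below
      \<open>y\<close>, so nondominance forces equality.\<close>
    have "y - t *\<^sub>R (r + r') \<in> ?Y"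
      using step[OF t(3)] unfolding matrix_vector_right_distrib Cdd
      by (simp add: scaleR_minus_right del: minus_add_distrib)
    then have "y - t *\<^sub>R (r + r') = y"
      using nd[of "y - t *\<^sub>R (r + r')"] r t(4) by simp
    then have rr: "r + r' = 0" using t(4) by simp
    have "r = 0"
    proof (rule vec_eq_iff[THEN iffD2], rule allI)
      fix i
      have "r $ i + r' $ i = 0" using rr by (metis vector_add_component zero_index)
      then show "r $ i = 0 $ i" using r[of i] by simp
    qed
    have Cd': "C *v d' = - (C *v d)" using Cdd rr by (simp add: add_eq_0_iff)
    \<comment> \<open>Otherwise \<open>d\<close> and \<open>d'\<close> move \<open>y\<close> in
      opposite directions, making it the midpoint of a segment in \<open>?Y\<close>.\<close>
    have "C *v d = 0"
    proof (rule ccontr)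
      assume "C *v d \<noteq> 0"
      then have "y \<in> open_segment (y + t *\<^sub>R (C *v d)) (y - t *\<^sub>R (C *v d))"
        unfolding in_segment using t(4)
        by (auto intro!: exI[of _ "1/2"] simp: algebra_simps simp flip: scaleR_left_distrib)
      moreover have "y + t *\<^sub>R (C *v d) \<in> ?Y" "y - t *\<^sub>R (C *v d) \<in> ?Y"
        using step[OF t(1)] step[OF t(2)] Cd' by simp_all
      ultimately show False using ext unfolding extreme_point_of_def by blast
    qed
    then show "k = 0" using p(2) \<open>r = 0\<close> by simp
  qed
  ultimately obtain w \<delta> where w: "\<delta> > 0" "\<And>k. k \<in> f ` D \<Longrightarrow> \<delta> * norm k \<le> w \<bullet> k"
    using pointed_cone_coercive_functional by metis
  show thesis
  proof (rule that)
    show "\<delta> > 0" by fact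
    show "w $ i > 0" for i
    proof -
      \<comment> \<open>The orthant part puts every unit vector into the cone, whence
        \<open>w $ i \<ge> \<delta>\<close>.\<close>
      have "(0, axis i 1) \<in> D" by (auto simp: D_def axis_def)
      then have "axis i 1 \<in> f ` D" by (force simp: f_def image_iff)
      from w(2)[OF this] w(1) show ?thesis by (simp add: inner_axis)
    qed
    fix y' assume "y' \<in> ?Y"
    then obtain x' where x': "x' \<in> ?X" "C *v x' = y'" by (auto simp: image_set_def)
    \<comment> \<open>Every feasible \<open>x'\<close> gives a feasible direction, so the bound
      holds on all of \<open>?Y\<close>, not only near \<open>y\<close>.\<close>
    then have "(x' - x, 0) \<in> D"
      using x by (auto simp: D_def feasible_set_def matrix_vector_mult_diff_distrib)
    then have "y' - y \<in> f ` D"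
      using x x' by (force simp: f_def image_iff matrix_vector_mult_diff_distrib)
    then show "\<delta> * norm (y' - y) \<le> w \<bullet> (y' - y)" by (rule w)
  qed
qed

section \<open>Nondominated images under monotone linear maps\<close>

lemma inner_less_of_positive_weights:
  fixes w :: "real^'k"
  assumes "\<And>i. w $ i > 0" "\<And>i. y' $ i \<le> y $ i" "y' \<noteq> y"
  shows "w \<bullet> y' < w \<bullet> y"
proof -
  obtain i where "y' $ i \<noteq> y $ i" using assms(3) by (auto simp: vec_eq_iff)
  then have "y' $ i < y $ i" using assms(2)[of i] by simp
  then have "(\<Sum>i\<in>UNIV. w $ i * y' $ i) < (\<Sum>i\<in>UNIV. w $ i * y $ i)"
    using assms by (intro sum_strict_mono_ex1) (auto intro!: mult_left_mono less_imp_le)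
  then show ?thesis by (simp add: inner_vec_def)
qed

text \<open>Among the preimages of \<open>z\<close>, which form a face of \<open>Y\<close>, those minimising a positive weight
  are nondominated; coercivity makes them a compact face.\<close>

lemma extreme_nondominated_image_lift:
  fixes Y :: "(real^'k) set" and M :: "real^'k \<Rightarrow> real^'l"
  assumes "closed Y" "convex Y" "linear M"
    and mono: "\<And>u v i. (\<And>i. u $ i \<le> v $ i) \<Longrightarrow> M u $ i \<le> M v $ i"
    and "\<delta> > 0" and wpos: "\<And>i. w $ i > 0"
    and coercive: "\<And>y. y \<in> Y \<Longrightarrow> \<delta> * norm (y - y0) \<le> w \<bullet> (y - y0)"
    and z: "nondominated (M ` Y) z" "z extreme_point_of (M ` Y)"
  obtains y where "nondominated Y y" "y extreme_point_of Y" "M y = z"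
proof -
  define F where "F = Y \<inter> M -` {z}"
  have "convex F"
    unfolding F_def using assms(2,3) by (intro convex_Int convex_linear_vimage) auto
  have "closed F"
    unfolding F_def using assms(1,3)
    by (intro closed_Int closed_vimage) (auto intro: linear_continuous_on simp: linear_conv_bounded_linear)
  have "F face_of Y"
    unfolding face_of_def
  proof (intro conjI ballI impI)
    show "F \<subseteq> Y" by (auto simp: F_def)
    show "convex F" by fact
    fix a c x assume a: "a \<in> Y" "c \<in> Y" "x \<in> F" "x \<in> open_segment a c"
    then obtain u where u: "0 < u" "u < 1" "x = (1 - u) *\<^sub>R a + u *\<^sub>R c"
      by (auto simp: in_segment)
    have eq: "z = (1 - u) *\<^sub>R M a + u *\<^sub>R M c"
      using a(3) u(3) assms(3) by (auto simp: F_def linear_add linear_scale)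
    have "M a = M c"
      using z(2) a(1,2) eq u(1,2) unfolding extreme_point_of_def in_segment by blast
    then have "M a = z" "M c = z" using eq by (auto simp flip: scaleR_left_distrib)
    then show "a \<in> F" "c \<in> F" using a by (auto simp: F_def)
  qed
  obtain p where "p \<in> F" using z(1) by (auto simp: F_def nondominated_def)
  \<comment> \<open>The point \<open>y0\<close> may lie outside \<open>F\<close>: coercivity about
    any one point bounds the sublevel sets of \<open>w\<close>.\<close>
  define L where "L = F \<inter> {y. w \<bullet> y \<le> w \<bullet> p}"
  have "L \<subseteq> cball y0 ((w \<bullet> p - w \<bullet> y0) / \<delta>)"
    using coercive \<open>\<delta> > 0\<close>
    by (fastforce simp: L_def F_def dist_norm norm_minus_commute field_simps inner_diff_right)
  then have "compact L"
    using \<open>closed F\<close> unfolding compact_eq_bounded_closed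
    by (metis L_def bounded_cball bounded_subset closed_Int closed_halfspace_le)
  moreover have "p \<in> L" using \<open>p \<in> F\<close> by (simp add: L_def)
  ultimately obtain q where q: "q \<in> L" "\<And>y. y \<in> L \<Longrightarrow> w \<bullet> q \<le> w \<bullet> y"
    using continuous_attains_inf[of L "\<lambda>y. w \<bullet> y"]
      continuous_on_inner[OF continuous_on_const continuous_on_id]
    by (metis empty_iff)
  have qmin: "w \<bullet> q \<le> w \<bullet> y" if "y \<in> F" for y
    using q that by (cases "w \<bullet> y \<le> w \<bullet> p") (auto simp: L_def)
  define E where "E = F \<inter> {y. w \<bullet> y = w \<bullet> q}"
  have "E face_of F"
    unfolding E_def using \<open>convex F\<close> qmin by (intro face_of_Int_supporting_hyperplane_ge) auto
  moreover have "E = L \<inter> {y. w \<bullet> y = w \<bullet> q}" using q(1) by (auto simp: E_def L_def)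
  then have "compact E" using \<open>compact L\<close> by (simp add: compact_Int_closed closed_hyperplane)
  moreover have "q \<in> E" using q(1) by (auto simp: E_def L_def)
  ultimately obtain y where y: "y extreme_point_of E"
    using extreme_point_exists_convex[of E] face_of_imp_convex by blast
  then have "y \<in> E" by (simp add: extreme_point_of_def)
  have "y extreme_point_of Y"
    using y face_of_trans[OF \<open>E face_of F\<close> \<open>F face_of Y\<close>] extreme_point_of_face by blast
  moreover have "nondominated Y y"
    unfolding nondominated_def
  proof (intro conjI notI)
    show "y \<in> Y" using \<open>y \<in> E\<close> by (auto simp: E_def F_def)
    assume "\<exists>y'\<in>Y. y' \<noteq> y \<and> (\<forall>i. y' $ i \<le> y $ i)"
    then obtain y' where y': "y' \<in> Y" "y' \<noteq> y" "\<And>i. y' $ i \<le> y $ i" by blast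
    have "M y = z" using \<open>y \<in> E\<close> by (auto simp: E_def F_def)
    \<comment> \<open>\<open>M y'\<close> is weakly below \<open>z\<close>, so nondominance of
      \<open>z\<close> puts \<open>y'\<close> back into \<open>F\<close>, where
      \<open>w \<bullet> q\<close> is minimal.\<close>
    then have "M y' = z"
      using z(1) mono[of y' y] y' unfolding nondominated_def by blast
    then have "w \<bullet> q \<le> w \<bullet> y'" using y'(1) qmin by (auto simp: F_def)
    moreover have "w \<bullet> y' < w \<bullet> y" using inner_less_of_positive_weights wpos y' by blast
    ultimately show False using \<open>y \<in> E\<close> by (simp add: E_def)
  qed
  moreover have "M y = z" using \<open>y \<in> E\<close> by (auto simp: E_def F_def)
  ultimately show thesis using that by blast
qed

text \<open>A dominating point would have a smaller \<open>v\<close>-value, and the supporting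
  hyperplane at the minimum meets \<open>Z\<close> in \<open>z\<close> alone.\<close>

lemma unique_minimiser_extreme_nondominated:
  fixes Z :: "(real^'k) set"
  assumes "z \<in> Z" "\<And>i. v $ i > 0" and min: "\<And>z'. z' \<in> Z \<Longrightarrow> z' \<noteq> z \<Longrightarrow> v \<bullet> z < v \<bullet> z'"
  shows "nondominated Z z" "z extreme_point_of Z"
proof -
  show "nondominated Z z"
    using assms inner_less_of_positive_weights[of v _ z] unfolding nondominated_def
    by (meson order_less_asym)
  have "Z \<inter> {x. v \<bullet> x = v \<bullet> z} = {z}" using assms(1) min by force
  then show "z extreme_point_of Z"
    using min by (intro extreme_point_of_Int_supporting_hyperplane_ge) (auto simp: less_le)
qed

section \<open>Passage from three objectives to two\<close>

text \<open>The map written \<open>M\<^sub>\<lambda>\<close> in the overview, with \<open>l\<close>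
  for \<open>\<lambda>\<close>.\<close>

definition scalarise :: "nat \<Rightarrow> real \<Rightarrow> real^3 \<Rightarrow> real^2" where
  "scalarise j l y = vector [y $ 1 + l * y $ 3, y $ 2 + (if j = 1 then 0 else l * y $ 3)]"

lemma scalarise_nth [simp]:
  "scalarise j l y $ 1 = y $ 1 + l * y $ 3"
  "scalarise j l y $ 2 = y $ 2 + (if j = 1 then 0 else l * y $ 3)"
  by (simp_all add: scalarise_def vector_2)

lemma linear_scalarise: "linear (scalarise j l)"
  by (rule linearI) (auto simp: vec_eq_iff forall_2 algebra_simps)

lemma scalarise_mono:
  assumes "l \<ge> 0" "\<And>i. u $ i \<le> v $ i"
  shows "scalarise j l u $ i \<le> scalarise j l v $ i"
proof -
  have "scalarise j l u $ 1 \<le> scalarise j l v $ 1" "scalarise j l u $ 2 \<le> scalarise j l v $ 2"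
    using assms by (auto intro!: add_mono mult_left_mono)
  then show ?thesis using exhaust_2[of i] by auto
qed

lemma pblp_eq_scalarise_tolp:
  "pblp j c1 c2 d1 l *v x = scalarise j l (tolp c1 c2 d1 *v x)"
  by (auto simp: vec_eq_iff forall_2 pblp_def pblp1_def pblp2_def tolp_def vector_2 vector_3
      matrix_vector_mul_component inner_add_left)

lemma image_set_pblp:
  "image_set (pblp j c1 c2 d1 l) X = scalarise j l ` image_set (tolp c1 c2 d1) X"
  by (auto simp: image_set_def pblp_eq_scalarise_tolp)

lemma inner_scalarise:
  assumes "\<And>i. w $ i > 0"
  obtains l v where "l \<ge> 0" "\<And>i. v $ i > 0" "\<And>y. v \<bullet> scalarise j l y = w \<bullet> y"
proof (rule that)
  have w: "w $ 1 > 0" "w $ 2 > 0" "w $ 3 > 0" using assms by auto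
  \<comment> \<open>Comparing the coefficients of \<open>y $ 1\<close> and \<open>y $ 2\<close>
    gives \<open>?v\<close>; that of \<open>y $ 3\<close> then determines \<open>?l\<close>.\<close>
  let ?l = "w $ 3 / (if j = 1 then w $ 1 else w $ 1 + w $ 2)"
  let ?v = "vector [w $ 1, w $ 2] :: real^2"
  show "?l \<ge> 0" using w by simp
  show "?v $ i > 0" for i using exhaust_2[of i] w by (auto simp: vector_2)
  show "?v \<bullet> scalarise j ?l y = w \<bullet> y" for y
    using w by (simp add: inner_vec_def sum_2 sum_3 vector_2 field_simps)
qed

section \<open>Equivalence of the solution sets\<close>

text \<open>The assumption \<open>ne\<close> excludes cases such as an image that is a line along
  the third axis. There TOLP has no extreme nondominated image, but the problem at
  \<open>l = 0\<close> has one, so the empty set would solve only TOLP.\<close>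

lemma parametric_solution_set_iff:
  assumes X: "X = feasible_set A b"
    and ne: "X \<noteq> {} \<longrightarrow> extreme_nondominated (tolp c1 c2 d1) X \<noteq> {}"
  shows "parametric_solution_set (pblp j c1 c2 d1) X S \<longleftrightarrow> solution_set (tolp c1 c2 d1) X S"
proof
  let ?C = "tolp c1 c2 d1"
  let ?Y = "image_set ?C X"
  assume par: "parametric_solution_set (pblp j c1 c2 d1) X S"
  have "\<exists>x\<in>S. ?C *v x = y" if y: "y \<in> extreme_nondominated ?C X" for y
  proof -
    obtain w \<delta> where w: "\<delta> > 0" "\<And>i. w $ i > 0"
      "\<And>y'. y' \<in> ?Y \<Longrightarrow> \<delta> * norm (y' - y) \<le> w \<bullet> (y' - y)"
      using extreme_nondominated_coercive_weights y unfolding X by metis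
    obtain l v where l: "l \<ge> 0" and v: "\<And>i. v $ i > 0" "\<And>y. v \<bullet> scalarise j l y = w \<bullet> y"
      using inner_scalarise[OF w(2)] by metis
    have less: "w \<bullet> y < w \<bullet> y'" if "y' \<in> ?Y" "y' \<noteq> y" for y'
    proof -
      have "0 < \<delta> * norm (y' - y)" using w(1) that(2) by simp
      also have "\<dots> \<le> w \<bullet> (y' - y)" using w(3) that(1) by blast
      finally show ?thesis by (simp add: inner_diff_right)
    qed
    have "y \<in> ?Y" using y by (simp add: extreme_nondominated_def nondominated_def)
    have "v \<bullet> scalarise j l y < v \<bullet> z'" if "z' \<in> scalarise j l ` ?Y" "z' \<noteq> scalarise j l y" for z'
      using that less by (force simp: v(2))
    then have "scalarise j l y \<in> extreme_nondominated (pblp j c1 c2 d1 l) X"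
      unfolding extreme_nondominated_def image_set_pblp
      using unique_minimiser_extreme_nondominated[of "scalarise j l y" "scalarise j l ` ?Y" v]
        v(1) \<open>y \<in> ?Y\<close> by simp
    then obtain x where x: "x \<in> S" "pblp j c1 c2 d1 l *v x = scalarise j l y"
      using par l unfolding parametric_solution_set_def solution_set_def by blast
    \<comment> \<open>The image of \<open>x\<close> attains the minimum of \<open>w\<close>, and
      \<open>y\<close> is the only minimiser.\<close>
    then have "w \<bullet> (?C *v x) = w \<bullet> y"
      using v(2) by (metis pblp_eq_scalarise_tolp)
    moreover have "?C *v x \<in> ?Y"
      using x(1) par by (auto simp: parametric_solution_set_def image_set_def)
    ultimately have "?C *v x = y" using less by fastforce
    then show ?thesis using x(1) by blast
  qed
  then show "solution_set ?C X S"
    using par by (simp add: solution_set_def parametric_solution_set_def)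
next
  let ?C = "tolp c1 c2 d1"
  let ?Y = "image_set ?C X"
  assume sol: "solution_set ?C X S"
  have "\<exists>x\<in>S. pblp j c1 c2 d1 l *v x = z"
    if l: "l \<ge> 0" and z: "z \<in> extreme_nondominated (pblp j c1 c2 d1 l) X" for l z
  proof -
    have z': "nondominated (scalarise j l ` ?Y) z" "z extreme_point_of (scalarise j l ` ?Y)"
      using z by (auto simp: extreme_nondominated_def image_set_pblp)
    then have "X \<noteq> {}" by (auto simp: nondominated_def image_set_def)
    \<comment> \<open>One \<open>y0\<close> serves every \<open>l\<close> and \<open>z\<close>,
      since only the coercivity of its weight matters.\<close>
    then obtain y0 where "y0 \<in> extreme_nondominated ?C X" using ne by blast
    then obtain w \<delta> where w: "\<delta> > 0" "\<And>i. w $ i > 0"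
      "\<And>y'. y' \<in> ?Y \<Longrightarrow> \<delta> * norm (y' - y0) \<le> w \<bullet> (y' - y0)"
      using extreme_nondominated_coercive_weights unfolding X by metis
    have "closed ?Y" "convex ?Y"
      unfolding X by (rule closed_image_feasible_set convex_image_feasible_set)+
    then obtain y where "nondominated ?Y y" "y extreme_point_of ?Y" "scalarise j l y = z"
      using extreme_nondominated_image_lift[OF _ _ linear_scalarise scalarise_mono[OF l] w z']
      by metis
    then show ?thesis
      using sol by (force simp: solution_set_def extreme_nondominated_def pblp_eq_scalarise_tolp)
  qed
  \<comment> \<open>The subset \<open>T\<close> is \<open>S\<close> itself for every
    \<open>l\<close>.\<close>
  then show "parametric_solution_set (pblp j c1 c2 d1) X S"
    using sol by (auto simp: parametric_solution_set_def solution_set_def)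
qed

theorem proposition22:
  fixes A :: "real^'n^'m" and b :: "real^'m" and c1 c2 d1 :: "real^'n"
    and X S :: "(real^'n) set" and j :: nat
  assumes "\<forall>i k. A $ i $ k \<in> \<rat>" and "\<forall>i. b $ i \<in> \<rat>"
    and "\<forall>k. c1 $ k \<in> \<rat>" and "\<forall>k. c2 $ k \<in> \<rat>" and "\<forall>k. d1 $ k \<in> \<rat>"
    and "X = feasible_set A b"
    and "X \<noteq> {} \<longrightarrow> extreme_nondominated (tolp c1 c2 d1) X \<noteq> {}"
    and "j \<in> {1, 2}"
    and "S \<subseteq> X"
  shows "minimal_solution_set (tolp c1 c2 d1) X S
     \<longleftrightarrow> minimal_parametric_solution_set (pblp j c1 c2 d1) X S"
  \<comment> \<open>The equivalence holds for every set, so it also rewrites the competitors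
    \<open>S'\<close>.\<close>
  unfolding minimal_solution_set_def minimal_parametric_solution_set_def
  by (simp add: parametric_solution_set_iff[OF assms(6,7)])

end
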